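(* The set $(\mathcal{C}(\partial D,\mathbb{C})\setminus\overline{\mathrm{Pol}(\partial D)})\cup\{0\}$ contains an isometric copy of $\mathrm{Hol}(\partial D)$. In particular, $\varphi[\mathrm{Hol}(\partial D)]\setminus\{0\}\subseteq\mathcal{C}(\partial D,\mathbb{C})\setminus\overline{\mathrm{Pol}(\partial D)}$.
   Context: $D=\{z\in\mathbb{C}:|z|<1\}$ and $\partial D$ is the unit circle. $\mathcal{C}(\partial D,\mathbb{C})$ is the Banach space of continuous functions $\partial D\to\mathbb{C}$ with the sup-norm. $\mathrm{Pol}(\partial D):=\{f|_{\partial D}:f\in\mathbb{C}[z]\}$ (complex polynomials in one variable restricted to $\partial D$), with norm closure $\overline{\mathrm{Pol}(\partial D)}$. $\mathrm{Hol}(\partial D):=\{f|_{\partial D}: f\in\mathcal{C}(\overline{D},\mathbb{C})\text{ is holomorphic on }D\}$, with the sup-norm. The map $\varphi:\mathcal{C}(\partial D,\mathbb{C})\to\mathcal{C}(\partial D,\mathbb{C})$ is defined by $\varphi(f)(z)=\bar z f(\bar z)$. An isometric copy of $\mathrm{Hol}(\partial D)$ means a linear subspace that is linearly isometric to $\mathrm{Hol}(\partial D)$. *)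

theory Defs
  imports "HOL-Complex_Analysis.Complex_Analysis"
begin

typedef circle = "sphere (0::complex) 1"
  morphisms of_circle Abs_circle
  by (rule exI[of _ 1]) simp

setup_lifting type_definition_circle

instantiation circle :: metric_space
begin

lift_definition dist_circle :: "circle \<Rightarrow> circle \<Rightarrow> real" is dist .

definition uniformity_circle :: "(circle \<times> circle) filter" where
  "uniformity_circle = (INF e\<in>{0 <..}. principal {(x, y). dist x y < e})"

definition open_circle :: "circle set \<Rightarrow> bool" where
  "open_circle U = (\<forall>x\<in>U. eventually (\<lambda>(x', y). x' = x \<longrightarrow> y \<in> U) uniformity)"

instance
proof
  fix x y z :: circle
  show "dist x y = 0 \<longleftrightarrow> x = y"
    by transfer simp
  show "dist x y \<le> dist x z + dist y z"
    by transfer (rule dist_triangle2)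
qed (simp_all add: uniformity_circle_def open_circle_def)

end

lemma continuous_on_of_circle [continuous_intros]:
  "continuous_on S f \<Longrightarrow> continuous_on S (\<lambda>x. of_circle (f x))"
  by (rule continuous_on_compose2[where t = UNIV and g = of_circle])
    (auto simp: continuous_on_iff dist_circle.rep_eq)

lemma continuous_on_Abs_circle: "continuous_on (sphere 0 1) Abs_circle"
  unfolding continuous_on_iff by (auto simp: dist_circle.rep_eq Abs_circle_inverse)

lemma compact_UNIV_circle: "compact (UNIV :: circle set)"
proof -
  have "compact (Abs_circle ` sphere 0 1)"
    by (intro compact_continuous_image continuous_on_Abs_circle) simp
  moreover have "Abs_circle ` sphere 0 1 = UNIV"
    using type_definition.Abs_image[OF type_definition_circle] .
  ultimately show ?thesis
    by simp
qed

text \<open>Since the circle is compact, the Banach space of bounded continuous functions from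
  the circle to the complex numbers is the space of all continuous functions,
  with the supremum norm.\<close>

lemma bcontfun_circle:
  fixes f :: "circle \<Rightarrow> complex"
  shows "f \<in> bcontfun \<longleftrightarrow> continuous_on UNIV f"
  using compact_imp_bounded[OF compact_continuous_image[OF _ compact_UNIV_circle]]
  by (auto simp: bcontfun_def)

lift_definition cnj_circle :: "circle \<Rightarrow> circle" is cnj
  by simp

lemma continuous_on_cnj_circle [continuous_intros]:
  "continuous_on S f \<Longrightarrow> continuous_on S (\<lambda>x. cnj_circle (f x))"
  by (rule continuous_on_compose2[where t = UNIV and g = cnj_circle])
    (auto simp: continuous_on_iff dist_circle.rep_eq cnj_circle.rep_eq dist_norm
      simp flip: complex_cnj_diff)

type_synonym cfun = "circle \<Rightarrow>\<^sub>C complex"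

text \<open>The library only provides the real vector space structure on bounded continuous
  functions.\<close>

definition cscale :: "complex \<Rightarrow> cfun \<Rightarrow> cfun" where
  "cscale c f = Bcontfun (\<lambda>z. c * f z)"

lemma apply_cscale [simp]: "cscale c f z = c * f z"
  by (simp add: cscale_def Bcontfun_inverse bcontfun_circle continuous_intros)

interpretation cfun: vector_space cscale
  by standard (rule bcontfun_eqI, simp add: algebra_simps)+

definition Pol :: "cfun set" where
  "Pol = {f :: cfun. \<exists>p :: complex poly. \<forall>z. f z = poly p (of_circle z)}"

definition Hol :: "cfun set" where
  "Hol = {f :: cfun. \<exists>F. continuous_on (cball 0 1) F \<and> F holomorphic_on ball 0 1 \<and>
                 (\<forall>z. f z = F (of_circle z))}"

definition phi :: "cfun \<Rightarrow> cfun" where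
  "phi f = Bcontfun (\<lambda>z. cnj (of_circle z) * f (cnj_circle z))"

lemma apply_phi [simp]: "phi f z = cnj (of_circle z) * f (cnj_circle z)"
proof -
  have "continuous_on UNIV (\<lambda>z. f (cnj_circle z))"
    by (rule continuous_on_compose2[of UNIV "apply_bcontfun f"]) (auto intro!: continuous_intros)
  then show ?thesis
    by (simp add: phi_def Bcontfun_inverse bcontfun_circle continuous_intros)
qed

definition isometric_copy :: "cfun set \<Rightarrow> cfun set \<Rightarrow> bool" where
  "isometric_copy N M \<longleftrightarrow> cfun.subspace M \<and>
     (\<exists>T. bij_betw T N M \<and>
          (\<forall>f\<in>N. \<forall>g\<in>N. T (f + g) = T f + T g) \<and>
          (\<forall>c. \<forall>f\<in>N. T (cscale c f) = cscale c (T f)) \<and>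
          (\<forall>f\<in>N. norm (T f) = norm f))"

lemma subspace_Hol: "cfun.subspace Hol"
proof (rule cfun.subspaceI)
  show "0 \<in> Hol"
    by (auto simp: Hol_def intro!: exI[of _ "\<lambda>_. 0"])
next
  fix f g assume "f \<in> Hol" "g \<in> Hol"
  then obtain F G where
    "continuous_on (cball 0 1) F" "F holomorphic_on ball 0 1" "\<forall>z. f z = F (of_circle z)"
    "continuous_on (cball 0 1) G" "G holomorphic_on ball 0 1" "\<forall>z. g z = G (of_circle z)"
    by (auto simp: Hol_def)
  then show "f + g \<in> Hol"
    by (auto simp: Hol_def intro!: exI[of _ "\<lambda>z. F z + G z"] continuous_intros holomorphic_intros)
next
  fix c f assume "f \<in> Hol"
  then obtain F where
    "continuous_on (cball 0 1) F" "F holomorphic_on ball 0 1" "\<forall>z. f z = F (of_circle z)"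
    by (auto simp: Hol_def)
  then show "cscale c f \<in> Hol"
    by (auto simp: Hol_def intro!: exI[of _ "\<lambda>z. c * F z"] continuous_intros
      holomorphic_intros)
qed

end

theory Submission
  imports Defs
begin

text \<open>On the circle, \<open>cnj z = 1 / z\<close>, so \<open>phi\<close> moves the Fourier coefficient at
  frequency \<open>n\<close> to frequency \<open>- n - 1\<close>. Functions in \<open>Hol\<close> have frequencies \<open>n \<ge> 0\<close> only, hence
  their images have negative frequencies only, whereas uniform limits of polynomials
  have frequencies \<open>n \<ge> 0\<close> only. A function of both kinds is orthogonal to itself for the
  \<open>L\<^sup>2\<close> inner product on the circle, so it vanishes.

  This orthogonality comes directly from Cauchy's theorem. If \<open>F\<close> extends \<open>f \<in> Hol\<close>
  to the disc, then the conjugate of \<open>phi f z\<close> is \<open>z * cnj (F (cnj z))\<close>, and the factor \<open>z\<close> is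
  exactly what turns the integral of \<open>p * cnj (phi f)\<close> over the angle into a
  contour integral of \<open>p z * cnj (F (cnj z))\<close>. The theorem says that it is zero
  (\<open>Pol_orthogonal_phi_Hol\<close>), and this orthogonality passes to uniform limits
  (\<open>closure_Pol_orthogonal_phi_Hol\<close>). Finally, \<open>phi\<close> is a linear isometric involution, so
  \<open>phi ` Hol\<close> is itself an isometric copy of \<open>Hol\<close>.\<close>

lemma phi_phi [simp]: "phi (phi f) = f"
proof (rule bcontfun_eqI)
  fix z
  have "cnj_circle (cnj_circle z) = z"
    by transfer simp
  moreover have "cnj (of_circle z) * of_circle z = 1"
    using of_circle[of z] complex_norm_square[of "of_circle z"] by (simp add: mult.commute)
  ultimately show "phi (phi f) z = f z"
    by (simp add: cnj_circle.rep_eq flip: mult.assoc)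
qed

lemma phi_add: "phi (f + g) = phi f + phi g"
  by (rule bcontfun_eqI) (simp add: algebra_simps)

lemma phi_cscale: "phi (cscale c f) = cscale c (phi f)"
  by (rule bcontfun_eqI) (simp add: algebra_simps)

text \<open>The factor \<open>cnj z\<close> has modulus one, so \<open>phi\<close> does not increase the norm; being an
  involution, it cannot decrease it either.\<close>

lemma norm_phi: "norm (phi f) = norm f"
proof (rule antisym)
  have le: "norm (phi g) \<le> norm g" for g
  proof (rule norm_bound)
    fix z
    show "norm (phi g z) \<le> norm g"
      using of_circle[of z] norm_bounded[of g "cnj_circle z"] by (simp add: norm_mult)
  qed
  show "norm (phi f) \<le> norm f"
    by (rule le)
  show "norm f \<le> norm (phi f)"
    using le[of "phi f"] by simp
qed

lemma subspace_phi_image: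
  assumes "cfun.subspace N"
  shows "cfun.subspace (phi ` N)"
proof (rule cfun.subspaceI)
  have "phi 0 = 0"
    by (rule bcontfun_eqI) simp
  then show "0 \<in> phi ` N"
    using cfun.subspace_0[OF assms] by force
qed (auto simp: cfun.subspace_add[OF assms] cfun.subspace_scale[OF assms]
       simp flip: phi_add phi_cscale)

lemma isometric_copy_phi_image:
  assumes "cfun.subspace N"
  shows "isometric_copy N (phi ` N)"
proof -
  have "inj_on phi N"
    by (rule inj_on_inverseI[of _ phi]) simp
  then show ?thesis
    unfolding isometric_copy_def
    using subspace_phi_image[OF assms] phi_add phi_cscale norm_phi
    by (blast intro: bij_betw_imageI)
qed

definition circle_at :: "real \<Rightarrow> circle" where
  "circle_at t = Abs_circle (exp (2 * of_real pi * \<i> * of_real t))"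

lemma of_circle_at: "of_circle (circle_at t) = exp (2 * of_real pi * \<i> * of_real t)"
  by (simp add: circle_at_def Abs_circle_inverse)

lemma range_circle_at: "circle_at ` {0..1} = UNIV"
proof -
  have "z \<in> circle_at ` {0..1}" for z
  proof -
    have "of_circle z \<in> path_image (circlepath 0 1)"
      using of_circle[of z] by simp
    then obtain t where "t \<in> {0..1}" "of_circle z = of_circle (circle_at t)"
      by (auto simp: path_image_def circlepath of_circle_at)
    then show ?thesis
      by (metis image_eqI of_circle_inject)
  qed
  then show ?thesis
    by blast
qed

lemma continuous_on_circle_at: "continuous_on S (\<lambda>t. apply_bcontfun f (circle_at t))"
proof -
  have "continuous_on S (\<lambda>t. exp (2 * of_real pi * \<i> * complex_of_real t))"
    by (intro continuous_intros)
  then have "continuous_on S circle_at"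
    unfolding circle_at_def
    by (rule continuous_on_compose2[OF continuous_on_Abs_circle]) auto
  then show ?thesis
    by (rule continuous_on_compose2[OF continuous_on_apply_bcontfun]) (rule subset_UNIV)
qed

text \<open>The defining integral is the \<open>L\<^sup>2\<close> inner product for normalised arc length.\<close>

definition circle_inner :: "cfun \<Rightarrow> cfun \<Rightarrow> complex" where
  "circle_inner f g = integral {0..1} (\<lambda>t. f (circle_at t) * cnj (g (circle_at t)))"

lemma integrable_circle_inner:
  "(\<lambda>t. apply_bcontfun f (circle_at t) * cnj (apply_bcontfun g (circle_at t))) integrable_on {0..1}"
  by (intro integrable_continuous_real continuous_intros continuous_on_circle_at)

lemma circle_inner_diff_left: "circle_inner (f - g) h = circle_inner f h - circle_inner g h"
  unfolding circle_inner_def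
  by (subst integral_diff[symmetric])
    (auto simp: integrable_circle_inner algebra_simps minus_bcontfun.rep_eq)

lemma norm_circle_inner_le: "norm (circle_inner f g) \<le> norm f * norm g"
proof -
  have "norm (circle_inner f g) \<le> norm f * norm g * (1 - 0)"
    unfolding circle_inner_def
    by (intro integral_bound continuous_intros continuous_on_circle_at)
      (auto simp: norm_mult intro!: mult_mono norm_bounded)
  then show ?thesis
    by simp
qed

text \<open>The integrand is the continuous nonnegative function \<open>\<bar>g\<bar>\<^sup>2\<close>, whose integral vanishes only
  if it is zero everywhere.\<close>

lemma circle_inner_self_eq_0_imp:
  assumes "circle_inner g g = 0"
  shows "g = 0"
proof (rule bcontfun_eqI)
  fix z
  have cont: "continuous_on {0..1} (\<lambda>t. (norm (g (circle_at t)))\<^sup>2)"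
    by (intro continuous_intros continuous_on_circle_at)
  have "of_real (integral {0..1} (\<lambda>t. (norm (g (circle_at t)))\<^sup>2)) = circle_inner g g"
    unfolding circle_inner_def complex_norm_square[symmetric]
    using integral_linear[OF integrable_continuous_real[OF cont]
        bounded_linear_of_real[where 'a = complex]]
    by (simp add: o_def)
  then have "integral {0..1} (\<lambda>t. (norm (g (circle_at t)))\<^sup>2) = 0"
    using assms by simp
  then have "\<forall>t\<in>{0..1}. g (circle_at t) = 0"
    by (subst (asm) integral_eq_0_iff[OF cont]) auto
  moreover obtain t where "t \<in> {0..1}" "z = circle_at t"
    using range_circle_at by blast
  ultimately show "g z = (0 :: cfun) z"
    by simp
qed

text \<open>Reflecting \<open>F\<close> in the real axis on both sides gives a function \<open>z \<mapsto> cnj (F (cnj z))\<close> that is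
  again holomorphic in the disc and continuous up to the circle. The
  inner product is its contour integral against the polynomial, up to the factor \<open>2 * pi * \<i>\<close>.
  Since the integrand need not be holomorphic across the circle, Cauchy's theorem is applied
  in the form that asks only for continuity on the closed disc.\<close>

lemma Pol_orthogonal_phi_Hol:
  assumes "p \<in> Pol" "f \<in> Hol"
  shows "circle_inner p (phi f) = 0"
proof -
  obtain q where q: "\<And>z. p z = poly q (of_circle z)"
    using \<open>p \<in> Pol\<close> by (auto simp: Pol_def)
  obtain F where F: "continuous_on (cball 0 1) F" "F holomorphic_on ball 0 1"
    "\<And>z. f z = F (of_circle z)"
    using \<open>f \<in> Hol\<close> by (auto simp: Hol_def)
  define G where "G = (\<lambda>z. poly q z * cnj (F (cnj z)))"
  have "continuous_on (cball 0 1) G"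
    unfolding G_def
    by (intro continuous_intros continuous_on_compose2[OF F(1)]) auto
  moreover have "(cnj \<circ> F \<circ> cnj) holomorphic_on ball 0 1"
    by (intro holomorphic_on_compose_cnj_cnj holomorphic_on_subset[OF F(2)]) auto
  then have "G holomorphic_on ball 0 1"
    unfolding G_def o_def by (intro holomorphic_intros)
  ultimately have "(G has_contour_integral 0) (circlepath 0 1)"
    by (intro Cauchy_theorem_convex[where K = "{}" and S = "cball 0 1"])
      (auto simp: holomorphic_on_open field_differentiable_def)
  then have "((\<lambda>t. G (circlepath 0 1 t) * (2 * pi * \<i> * exp (2 * of_real pi * \<i> * of_real t)))
      has_integral 0) {0..1}"
    unfolding has_contour_integral_def
    by (rule has_integral_eq[rotated]) (simp add: vector_derivative_circlepath01)
  then have "((\<lambda>t. G (circlepath 0 1 t) * (2 * pi * \<i> * exp (2 * of_real pi * \<i> * of_real t))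
      / (2 * pi * \<i>)) has_integral 0 / (2 * pi * \<i>)) {0..1}"
    by (rule has_integral_divide)
  \<comment> \<open>The remaining exponential is \<open>z\<close>, the conjugate of the factor \<open>cnj z\<close> in \<open>phi\<close>.\<close>
  then have "((\<lambda>t. p (circle_at t) * cnj (phi f (circle_at t))) has_integral 0) {0..1}"
    by (simp add: G_def q F(3) circlepath of_circle_at cnj_circle.rep_eq mult_ac)
  then show ?thesis
    unfolding circle_inner_def by (rule integral_unique)
qed

text \<open>The inner product is continuous in the sup-norm: replacing \<open>g\<close> by a polynomial at
  distance \<open>d\<close> changes it by at most \<open>d * norm (phi f)\<close>.\<close>

lemma closure_Pol_orthogonal_phi_Hol:
  assumes "g \<in> closure Pol" "f \<in> Hol"
  shows "circle_inner g (phi f) = 0"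
proof -
  have "norm (circle_inner g (phi f)) \<le> 0 + e" if "e > 0" for e
  proof -
    \<comment> \<open>The summand 1 keeps the denominator positive when \<open>phi f\<close> is zero.\<close>
    define d where "d = e / (norm (phi f) + 1)"
    have pos: "norm (phi f) + 1 > 0"
      by (rule add_nonneg_pos) auto
    then have "d > 0"
      using that by (simp add: d_def)
    then obtain p where p: "p \<in> Pol" "norm (g - p) < d"
      using assms(1) by (metis closure_approachable dist_commute dist_norm)
    have "circle_inner g (phi f) = circle_inner (g - p) (phi f)"
      by (simp add: circle_inner_diff_left Pol_orthogonal_phi_Hol[OF p(1) assms(2)])
    also have "norm \<dots> \<le> norm (g - p) * norm (phi f)"
      by (rule norm_circle_inner_le)
    also have "\<dots> \<le> d * (norm (phi f) + 1)"
      using p(2) \<open>d > 0\<close> by (intro mult_mono) auto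
    also have "\<dots> = e"
      using pos by (simp add: d_def)
    finally show ?thesis
      by simp
  qed
  then have "norm (circle_inner g (phi f)) \<le> 0"
    by (rule field_le_epsilon)
  then show ?thesis
    by simp
qed

text \<open>An element \<open>phi f\<close> of \<open>closure Pol\<close> is orthogonal to itself.\<close>

lemma phi_image_Hol_avoids_closure_Pol: "phi ` Hol - {0} \<subseteq> UNIV - closure Pol"
  using closure_Pol_orthogonal_phi_Hol circle_inner_self_eq_0_imp by blast

theorem lemma3p20:
  shows "(\<exists>M. isometric_copy Hol M \<and> M \<subseteq> (UNIV - closure Pol) \<union> {0}) \<and>
         phi ` Hol - {0} \<subseteq> UNIV - closure Pol"
  using isometric_copy_phi_image[OF subspace_Hol] phi_image_Hol_avoids_closure_Pol
  by blast

end
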